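(* Let $\Gamma$ be a finite abelian group with $|\Gamma|\ge 2$, written additively, and let $d$ be a metric on $\Gamma$ satisfying $d(u,v)=d(u+w,v+w)$ for every $u,v,w\in\Gamma$. Then the spectral gap (second smallest eigenvalue, counted with multiplicity) of the normalized distance Laplacian $\mathcal D^{\mathcal L}(\Gamma,d)$ is at least $\frac23$. Moreover, if $\Gamma$ has odd order, then the spectral gap of $\mathcal D^{\mathcal L}(\Gamma,d)$ exceeds $0.718$.
   Context: For a finite metric space $(X,d)$, the distance matrix $\mathcal D=\mathcal D(X,d)$ is indexed by $X$ with entries $\mathcal D_{uv}=d(u,v)$; the transmission is $t(u)=\sum_{v\in X}d(u,v)$; the transmission matrix is $T=\operatorname{diag}(t(u):u\in X)$; and the normalized distance Laplacian is $\mathcal D^{\mathcal L}(X,d)=T^{-1/2}(T-\mathcal D)T^{-1/2}$. It is a real symmetric matrix whose smallest eigenvalue is $0$; its spectral gap is its second smallest eigenvalue, counted with multiplicity. *)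

theory Defs
  imports "HOL-Analysis.Analysis" "HOL-Computational_Algebra.Polynomial"
begin

(* A finite metric space is given by a function d with Metric_space UNIV d on a
   type of class finite; matrices indexed by the space have type real^'a^'a. *)

definition distance_matrix :: "('a::finite \<Rightarrow> 'a \<Rightarrow> real) \<Rightarrow> real^'a^'a" where
  "distance_matrix d = (\<chi> u v. d u v)"

definition transmission :: "('a::finite \<Rightarrow> 'a \<Rightarrow> real) \<Rightarrow> 'a \<Rightarrow> real" where
  "transmission d u = (\<Sum>v\<in>UNIV. d u v)"

definition diag_matrix :: "('a::finite \<Rightarrow> real) \<Rightarrow> real^'a^'a" where
  "diag_matrix f = (\<chi> u v. if u = v then f u else 0)"

definition transmission_matrix :: "('a::finite \<Rightarrow> 'a \<Rightarrow> real) \<Rightarrow> real^'a^'a" where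
  "transmission_matrix d = diag_matrix (transmission d)"

(* The negative square root of the transmission matrix is taken entrywise on the
   diagonal; in a metric space with at least two points all transmissions are positive. *)
definition transmission_matrix_inv_sqrt :: "('a::finite \<Rightarrow> 'a \<Rightarrow> real) \<Rightarrow> real^'a^'a" where
  "transmission_matrix_inv_sqrt d = diag_matrix (\<lambda>u. transmission d u powr (- 1 / 2))"

definition normalized_distance_laplacian :: "('a::finite \<Rightarrow> 'a \<Rightarrow> real) \<Rightarrow> real^'a^'a" where
  "normalized_distance_laplacian d =
     transmission_matrix_inv_sqrt d ** (transmission_matrix d - distance_matrix d)
       ** transmission_matrix_inv_sqrt d"

(* The polynomial det (x I - A), as a determinant over the ring of real polynomials. *)
definition char_polynomial :: "real^'n^'n \<Rightarrow> real poly" where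
  "char_polynomial A = det (mat [:0, 1:] - map_matrix (\<lambda>a. [:a:]) A)"

(* Nondecreasing list of the real eigenvalues, each repeated according to its algebraic
   multiplicity. For a real symmetric matrix this is the whole spectrum (its length is
   CARD('n)), and algebraic and geometric multiplicities agree. *)
definition eigenvalue_list :: "real^'n^'n \<Rightarrow> real list" where
  "eigenvalue_list A = sorted_list_of_multiset (proots (char_polynomial A))"

(* Second smallest eigenvalue (lists are indexed from 0); meaningful for a real symmetric
   matrix of size at least 2. *)
definition spectral_gap :: "real^'n^'n \<Rightarrow> real" where
  "spectral_gap A = eigenvalue_list A ! 1"

end

theory Submission
  imports Defs
begin

text \<open>
  By translation invariance \<open>d u v = f (u - v)\<close> with \<open>f\<close> nonnegative and subadditive, all
  transmissions equal \<open>t = \<Sum>f\<close>, and the eigenvalues of the Laplacian are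
  \<open>1 - (\<Sum>a. f a * \<phi> a) / t\<close> for the characters \<open>\<phi>\<close> of the group. For a nontrivial character,
  summing \<open>f (a + b) \<le> f a + f b\<close> against the nonnegative weight
  \<open>(1 - cos a - cos b + \<beta> * cos (a + b))\<^sup>2\<close>, where \<open>cos a\<close> is short for \<open>Re (\<phi> a)\<close>, bounds
  \<open>\<Sum>a. f a * cos a\<close> by \<open>t / 3\<close> for \<open>\<beta> = 1\<close> and by \<open>3 * t / (5 + 4 * sqrt 2) < 0.282 * t\<close>
  for \<open>\<beta> = sqrt 2\<close>. The second choice cancels the quadratic term. The computation needs \<open>\<phi>\<^sup>2\<close>
  to be nontrivial, which is automatic in odd order; if \<open>\<phi>\<close> is real, the weight
  \<open>(1 - \<phi> a) * (1 - \<phi> b)\<close> gives the bound \<open>t / 3\<close>.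
\<close>

section \<open>Characters and subadditive functions\<close>

definition character :: "('a::{finite, ab_group_add} \<Rightarrow> complex) \<Rightarrow> bool" where
  "character \<phi> \<longleftrightarrow> \<phi> 0 = 1 \<and> (\<forall>a b. \<phi> (a + b) = \<phi> a * \<phi> b)"

lemma sum_translate:
  fixes f :: "'a::{finite, ab_group_add} \<Rightarrow> 'b::comm_monoid_add"
  shows "(\<Sum>x\<in>UNIV. f (x + g)) = (\<Sum>x\<in>UNIV. f x)"
  by (rule sum.reindex_bij_witness[of _ "\<lambda>x. x - g" "\<lambda>x. x + g"]) auto

lemma sum_reflect:
  fixes f :: "'a::{finite, ab_group_add} \<Rightarrow> 'b::comm_monoid_add"
  shows "(\<Sum>x\<in>UNIV. f (g - x)) = (\<Sum>x\<in>UNIV. f x)"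
  by (rule sum.reindex_bij_witness[of _ "\<lambda>x. g - x" "\<lambda>x. g - x"]) auto

lemma character_nonzero:
  assumes "character \<phi>"
  shows "\<phi> a \<noteq> 0"
proof
  assume "\<phi> a = 0"
  moreover have "\<phi> (a + - a) = \<phi> a * \<phi> (- a)" "\<phi> 0 = 1"
    using assms unfolding character_def by blast+
  ultimately show False by simp
qed

text \<open>Translation by \<open>a\<close> permutes the factors of the product of all values of
  \<open>\<phi>\<close> and multiplies each by \<open>\<phi> a\<close>. The product is nonzero and
  cancels.\<close>

lemma character_power_card:
  fixes \<phi> :: "'a::{finite, ab_group_add} \<Rightarrow> complex"
  assumes "character \<phi>"
  shows "\<phi> a ^ CARD('a) = 1"
proof -
  have "(\<Prod>x\<in>UNIV. \<phi> x) = (\<Prod>x\<in>UNIV. \<phi> (x + a))"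
    by (rule prod.reindex_bij_witness[of _ "\<lambda>x. x + a" "\<lambda>x. x - a"]) auto
  also have "\<dots> = (\<Prod>x\<in>UNIV. \<phi> x) * \<phi> a ^ CARD('a)"
    using assms by (simp add: character_def prod.distrib)
  finally show ?thesis
    using character_nonzero[OF assms] by simp
qed

lemma norm_character:
  fixes \<phi> :: "'a::{finite, ab_group_add} \<Rightarrow> complex"
  assumes "character \<phi>"
  shows "norm (\<phi> a) = 1"
proof -
  have "norm (\<phi> a) ^ CARD('a) = 1"
    using character_power_card[OF assms, of a] by (metis norm_one norm_power)
  then show ?thesis
    by (metis norm_ge_zero power_eq_1_iff zero_less_card_finite less_irrefl real_norm_def abs_of_nonneg)
qed

lemma character_minus:
  assumes "character \<phi>"
  shows "\<phi> (- a) = cnj (\<phi> a)"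
proof -
  have "\<phi> (- a + a) = \<phi> (- a) * \<phi> a" "\<phi> 0 = 1"
    using assms unfolding character_def by blast+
  moreover have "cnj (\<phi> a) * \<phi> a = 1"
    using norm_character[OF assms, of a] complex_norm_square[of "\<phi> a"]
    by (simp add: mult.commute)
  ultimately show ?thesis
    using character_nonzero[OF assms, of a] by (metis add.left_inverse mult_right_cancel)
qed

text \<open>Translation by \<open>g\<close> permutes the terms but multiplies the sum by
  \<open>\<phi> g\<close>, which differs from 1.\<close>

lemma sum_character:
  assumes "character \<phi>" "\<phi> g \<noteq> 1"
  shows "(\<Sum>x\<in>UNIV. \<phi> x) = 0"
proof -
  have "(\<Sum>x\<in>UNIV. \<phi> x) = (\<Sum>x\<in>UNIV. \<phi> (x + g))"
    by (simp add: sum_translate)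
  also have "\<dots> = (\<Sum>x\<in>UNIV. \<phi> x) * \<phi> g"
    using assms(1) by (simp add: character_def sum_distrib_right)
  finally show ?thesis
    using assms(2) by simp
qed

lemma character_square: "character \<phi> \<Longrightarrow> character (\<lambda>a. \<phi> a ^ 2)"
  by (simp add: character_def power_mult_distrib)

text \<open>Sums the inequalities \<open>f (a + b) \<le> f a + f b\<close> with weights
  \<open>\<mu> a b\<close> and collects the coefficient of each value of \<open>f\<close>: the terms
  \<open>f a\<close> and \<open>f b\<close> contribute equal row sums by symmetry, and
  \<open>f (a + b)\<close> contributes the sum over pairs with a fixed sum.\<close>

lemma subadditive_weighted:
  fixes f :: "'a::{finite, ab_group_add} \<Rightarrow> real"
  assumes sub: "\<And>a b. f (a + b) \<le> f a + f b"
    and nonneg: "\<And>a b. 0 \<le> \<mu> a b" and comm: "\<And>a b. \<mu> a b = \<mu> b a"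
  shows "0 \<le> (\<Sum>a\<in>UNIV. f a * (2 * (\<Sum>b\<in>UNIV. \<mu> a b) - (\<Sum>b\<in>UNIV. \<mu> (a - b) b)))"
proof -
  have "0 \<le> (\<Sum>a\<in>UNIV. \<Sum>b\<in>UNIV. \<mu> a b * (f a + f b - f (a + b)))"
    by (intro sum_nonneg mult_nonneg_nonneg nonneg) (use sub in \<open>simp add: algebra_simps\<close>)
  also have "\<dots> = (\<Sum>a\<in>UNIV. \<Sum>b\<in>UNIV. f a * \<mu> a b) + (\<Sum>a\<in>UNIV. \<Sum>b\<in>UNIV. f b * \<mu> a b)
      - (\<Sum>a\<in>UNIV. \<Sum>b\<in>UNIV. f (a + b) * \<mu> a b)"
    by (simp add: algebra_simps sum.distrib sum_subtractf)
  also have "(\<Sum>a\<in>UNIV. \<Sum>b\<in>UNIV. f b * \<mu> a b) = (\<Sum>a\<in>UNIV. \<Sum>b\<in>UNIV. f a * \<mu> a b)"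
    by (subst sum.swap) (simp add: comm)
  also have "(\<Sum>a\<in>UNIV. \<Sum>b\<in>UNIV. f (a + b) * \<mu> a b) = (\<Sum>b\<in>UNIV. \<Sum>a\<in>UNIV. f (a + b) * \<mu> a b)"
    by (rule sum.swap)
  also have "\<dots> = (\<Sum>b\<in>UNIV. \<Sum>a\<in>UNIV. f a * \<mu> (a - b) b)"
  proof (rule sum.cong[OF refl])
    fix b
    show "(\<Sum>a\<in>UNIV. f (a + b) * \<mu> a b) = (\<Sum>a\<in>UNIV. f a * \<mu> (a - b) b)"
      using sum_translate[of "\<lambda>a. f a * \<mu> (a - b) b" b] by simp
  qed
  also have "\<dots> = (\<Sum>a\<in>UNIV. \<Sum>b\<in>UNIV. f a * \<mu> (a - b) b)"
    by (rule sum.swap)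
  finally show ?thesis
    by (simp add: algebra_simps sum.distrib sum_subtractf sum_distrib_left)
qed

text \<open>The values of \<open>\<phi>\<close> are 1 and -1, so the weight is 4 when
  \<open>a\<close> and \<open>b\<close> both lie outside the kernel and 0 otherwise; in the first
  case \<open>a + b\<close> lies in the kernel.\<close>

lemma subadditive_real_character:
  fixes f :: "'a::{finite, ab_group_add} \<Rightarrow> real"
  assumes sub: "\<And>a b. f (a + b) \<le> f a + f b"
    and \<phi>: "character \<phi>" "\<phi> g \<noteq> 1" and sq: "\<And>a. \<phi> a ^ 2 = 1"
  shows "3 * (\<Sum>a\<in>UNIV. f a * Re (\<phi> a)) \<le> (\<Sum>a\<in>UNIV. f a)"
proof -
  define c where "c = (\<lambda>a. Re (\<phi> a))"
  have \<phi>c: "\<phi> a = of_real (c a)" for a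
    using sq[of a] unfolding c_def power2_eq_1_iff by auto
  have c_sq: "c a * c a = 1" for a
    using sq[of a] unfolding c_def power2_eq_1_iff by auto
  have c_diff: "c (a - b) = c a * c b" for a b
    using \<phi>(1) character_minus[OF \<phi>(1), of b] unfolding character_def \<phi>c
    by (metis complex_cnj_complex_of_real diff_conv_add_uminus of_real_eq_iff of_real_mult)
  have sum_c: "(\<Sum>a\<in>UNIV. c a) = 0"
    using arg_cong[OF sum_character[OF \<phi>], of Re] by (simp add: c_def)
  define \<mu> where "\<mu> = (\<lambda>a b. (1 - c a) * (1 - c b))"
  have c_le: "c a \<le> 1" for a
    using norm_character[OF \<phi>(1), of a] complex_Re_le_cmod[of "\<phi> a"] by (simp add: c_def)
  have row: "(\<Sum>b\<in>UNIV. \<mu> a b) = real CARD('a) * (1 - c a)" for a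
    by (simp add: \<mu>_def sum_subtractf sum_c flip: sum_distrib_left)
  have eq: "\<mu> (a - b) b = 1 + c a - c b - c a * c b" for a b
  proof -
    have "\<mu> (a - b) b = 1 - c b - c a * c b + c a * (c b * c b)"
      unfolding \<mu>_def c_diff by algebra
    then show ?thesis by (simp add: c_sq)
  qed
  have diag: "(\<Sum>b\<in>UNIV. \<mu> (a - b) b) = real CARD('a) * (1 + c a)" for a
    unfolding eq by (simp add: sum_subtractf sum.distrib sum_c flip: sum_distrib_left)
  have "0 \<le> (\<Sum>a\<in>UNIV. f a * (2 * (\<Sum>b\<in>UNIV. \<mu> a b) - (\<Sum>b\<in>UNIV. \<mu> (a - b) b)))"
    by (rule subadditive_weighted[OF sub]) (use c_le in \<open>auto simp: \<mu>_def mult.commute\<close>)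
  also have "\<dots> = (\<Sum>a\<in>UNIV. real CARD('a) * (f a - 3 * (f a * c a)))"
    unfolding row diag by (intro sum.cong refl) algebra
  also have "\<dots> = real CARD('a) * ((\<Sum>a\<in>UNIV. f a) - 3 * (\<Sum>a\<in>UNIV. f a * c a))"
    by (simp add: sum_subtractf sum_distrib_left right_diff_distrib)
  finally show ?thesis
    by (simp add: c_def zero_le_mult_iff)
qed

text \<open>The row and diagonal sums of the squared weight involve only the first and second
  moments of the real and imaginary parts of \<open>\<phi>\<close>, which are known once
  \<open>\<phi>\<close> and its square both sum to zero.\<close>

lemma subadditive_complex_character:
  fixes f :: "'a::{finite, ab_group_add} \<Rightarrow> real" and \<beta> :: real
  assumes sub: "\<And>a b. f (a + b) \<le> f a + f b"
    and \<phi>: "character \<phi>" and g: "\<phi> g ^ 2 \<noteq> 1"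
  shows "0 \<le> (\<Sum>a\<in>UNIV. f a * ((1 + \<beta>\<^sup>2) - (5 + 4 * \<beta>) * Re (\<phi> a) + (2 - \<beta>\<^sup>2) * (Re (\<phi> a))\<^sup>2))"
proof -
  define c where "c = (\<lambda>a. Re (\<phi> a))"
  define s where "s = (\<lambda>a. Im (\<phi> a))"
  have pyth: "(c a)\<^sup>2 + (s a)\<^sup>2 = 1" for a
    using norm_character[OF \<phi>, of a] unfolding c_def s_def by (metis cmod_power2 one_power2)
  have c_add: "c (a + b) = c a * c b - s a * s b" for a b
    using \<phi> by (simp add: character_def c_def s_def)
  have c_diff: "c (a - b) = c a * c b + s a * s b" for a b
    using c_add[of a "- b"] character_minus[OF \<phi>, of b] by (simp add: c_def s_def)
  have g1: "\<phi> g \<noteq> 1" using g by auto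
  have sum_c: "(\<Sum>a\<in>UNIV. c a) = 0"
    using arg_cong[OF sum_character[OF \<phi> g1], of Re] by (simp add: c_def)
  have sum_s: "(\<Sum>a\<in>UNIV. s a) = 0"
    using arg_cong[OF sum_character[OF \<phi> g1], of Im] by (simp add: s_def)
  \<comment> \<open>The real part says that \<open>c\<close> and \<open>s\<close> have equal second
    moments, the imaginary part that they are uncorrelated.\<close>
  have sum2: "(\<Sum>a\<in>UNIV. \<phi> a ^ 2) = 0"
    by (rule sum_character[OF character_square[OF \<phi>] g])
  have diff: "(\<Sum>a\<in>UNIV. (c a)\<^sup>2) - (\<Sum>a\<in>UNIV. (s a)\<^sup>2) = 0"
    using arg_cong[OF sum2, of Re]
    by (simp add: c_def s_def power2_eq_square sum_subtractf)
  have sum_cs: "(\<Sum>a\<in>UNIV. c a * s a) = 0"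
    using arg_cong[OF sum2, of Im]
    by (simp add: c_def s_def power2_eq_square mult.commute[of "Im _"]
      flip: sum_distrib_left)
  have tot: "(\<Sum>a\<in>UNIV. (c a)\<^sup>2) + (\<Sum>a\<in>UNIV. (s a)\<^sup>2) = real CARD('a)"
    by (simp add: pyth flip: sum.distrib)
  define N where "N = real CARD('a)"
  have sum_cc: "(\<Sum>a\<in>UNIV. (c a)\<^sup>2) = N / 2" and sum_ss: "(\<Sum>a\<in>UNIV. (s a)\<^sup>2) = N / 2"
    using tot diff by (auto simp: N_def)
  have mean: "(\<Sum>b\<in>UNIV. (k - p * c b - q * s b)\<^sup>2) = N * (k\<^sup>2 + p\<^sup>2 / 2 + q\<^sup>2 / 2)" for k p q :: real
  proof -
    have "(k - p * c b - q * s b)\<^sup>2 = k\<^sup>2 - 2 * k * p * c b - 2 * k * q * s b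
        + p\<^sup>2 * (c b)\<^sup>2 + q\<^sup>2 * (s b)\<^sup>2 + 2 * p * q * (c b * s b)" for b
      by algebra
    then have "(\<Sum>b\<in>UNIV. (k - p * c b - q * s b)\<^sup>2)
        = N * k\<^sup>2 + p\<^sup>2 * (N / 2) + q\<^sup>2 * (N / 2)"
      by (simp add: sum.distrib sum_subtractf sum_c sum_s sum_cc sum_ss sum_cs N_def
        flip: sum_distrib_left)
    then show ?thesis
      by (simp add: algebra_simps)
  qed
  define \<mu> where "\<mu> = (\<lambda>a b. (1 - c a - c b + \<beta> * c (a + b))\<^sup>2)"
  \<comment> \<open>By the addition formulas both weights are squares of
    \<open>k - p * c b - q * s b\<close>: for the row \<open>k = 1 - c a\<close>,
    \<open>p = 1 - \<beta> * c a\<close>, \<open>q = \<beta> * s a\<close>; for the diagonal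
    \<open>k = 1 + \<beta> * c a\<close>, \<open>p = 1 + c a\<close>,
    \<open>q = s a\<close>.\<close>
  have row: "(\<Sum>b\<in>UNIV. \<mu> a b) = N * ((1 - c a)\<^sup>2 + (1 - \<beta> * c a)\<^sup>2 / 2 + (\<beta> * s a)\<^sup>2 / 2)" for a
    unfolding mean[symmetric] \<mu>_def by (simp add: c_add algebra_simps)
  have diag: "(\<Sum>b\<in>UNIV. \<mu> (a - b) b) = N * ((1 + \<beta> * c a)\<^sup>2 + (1 + c a)\<^sup>2 / 2 + (s a)\<^sup>2 / 2)" for a
    unfolding mean[symmetric] \<mu>_def by (simp add: c_diff algebra_simps)
  have "0 \<le> (\<Sum>a\<in>UNIV. f a * (2 * (\<Sum>b\<in>UNIV. \<mu> a b) - (\<Sum>b\<in>UNIV. \<mu> (a - b) b)))"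
    by (rule subadditive_weighted[OF sub]) (auto simp: \<mu>_def algebra_simps)
  also have "\<dots> = (\<Sum>a\<in>UNIV. N * (f a * ((1 + \<beta>\<^sup>2) - (5 + 4 * \<beta>) * c a + (2 - \<beta>\<^sup>2) * (c a)\<^sup>2)))"
  proof (rule sum.cong[OF refl])
    fix a
    have ss: "(s a)\<^sup>2 = 1 - (c a)\<^sup>2" using pyth[of a] by simp
    show "f a * (2 * (\<Sum>b\<in>UNIV. \<mu> a b) - (\<Sum>b\<in>UNIV. \<mu> (a - b) b))
      = N * (f a * ((1 + \<beta>\<^sup>2) - (5 + 4 * \<beta>) * c a + (2 - \<beta>\<^sup>2) * (c a)\<^sup>2))"
      unfolding row diag power_mult_distrib ss by (simp add: power2_eq_square field_simps)
  qed
  finally show ?thesis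
    by (simp add: c_def N_def zero_le_mult_iff flip: sum_distrib_left)
qed

text \<open>For non-real \<open>\<phi>\<close>, the choice \<open>\<beta> = 1\<close> leaves the
  square of \<open>Re (\<phi> a)\<close> with coefficient 1. It is at most 1, and nonnegativity of
  \<open>f\<close> lets this bound be used termwise.\<close>

lemma subadditive_character_le:
  fixes f :: "'a::{finite, ab_group_add} \<Rightarrow> real"
  assumes sub: "\<And>a b. f (a + b) \<le> f a + f b" and nonneg: "\<And>a. 0 \<le> f a"
    and \<phi>: "character \<phi>" "\<phi> g \<noteq> 1"
  shows "3 * (\<Sum>a\<in>UNIV. f a * Re (\<phi> a)) \<le> (\<Sum>a\<in>UNIV. f a)"
proof (cases "\<forall>a. \<phi> a ^ 2 = 1")
  case True
  then show ?thesis
    using subadditive_real_character[OF sub \<phi>] by blast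
next
  case False
  then obtain h where h: "\<phi> h ^ 2 \<noteq> 1" by blast
  have "0 \<le> (\<Sum>a\<in>UNIV. f a * (2 - 9 * Re (\<phi> a) + (Re (\<phi> a))\<^sup>2))"
    using subadditive_complex_character[OF sub \<phi>(1) h, of 1] by simp
  also have "\<dots> \<le> (\<Sum>a\<in>UNIV. f a * (3 - 9 * Re (\<phi> a)))"
  proof (intro sum_mono mult_left_mono nonneg)
    fix a
    have "\<bar>Re (\<phi> a)\<bar> \<le> 1"
      using norm_character[OF \<phi>(1), of a] abs_Re_le_cmod[of "\<phi> a"] by simp
    then show "2 - 9 * Re (\<phi> a) + (Re (\<phi> a))\<^sup>2 \<le> 3 - 9 * Re (\<phi> a)"
      by (simp add: abs_square_le_1)
  qed
  also have "\<dots> = 3 * ((\<Sum>a\<in>UNIV. f a) - 3 * (\<Sum>a\<in>UNIV. f a * Re (\<phi> a)))"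
  proof -
    have "f a * (3 - 9 * Re (\<phi> a)) = 3 * (f a - 3 * (f a * Re (\<phi> a)))" for a
      by algebra
    then show ?thesis
      by (simp add: sum_subtractf flip: sum_distrib_left)
  qed
  finally show ?thesis by simp
qed

text \<open>In odd order \<open>\<phi> g ^ 2 = 1\<close> would force
  \<open>\<phi> g = \<phi> g ^ CARD('a) = 1\<close>. With \<open>\<beta> = sqrt 2\<close> the
  inequality is linear in \<open>Re (\<phi> a)\<close>.\<close>

lemma subadditive_character_le_odd:
  fixes f :: "'a::{finite, ab_group_add} \<Rightarrow> real"
  assumes sub: "\<And>a b. f (a + b) \<le> f a + f b"
    and \<phi>: "character \<phi>" "\<phi> g \<noteq> 1" and odd: "odd CARD('a)"
  shows "(5 + 4 * sqrt 2) * (\<Sum>a\<in>UNIV. f a * Re (\<phi> a)) \<le> 3 * (\<Sum>a\<in>UNIV. f a)"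
proof -
  have "\<phi> g ^ 2 \<noteq> 1"
  proof
    assume sq: "\<phi> g ^ 2 = 1"
    obtain k where "CARD('a) = 2 * k + 1" using odd oddE by blast
    then have "\<phi> g ^ CARD('a) = \<phi> g"
      by (simp add: power_mult sq)
    then show False
      using character_power_card[OF \<phi>(1), of g] \<phi>(2) by simp
  qed
  from subadditive_complex_character[OF sub \<phi>(1) this, of "sqrt 2"]
  have "0 \<le> (\<Sum>a\<in>UNIV. f a * (3 - (5 + 4 * sqrt 2) * Re (\<phi> a)))"
    by simp
  also have "\<dots> = 3 * (\<Sum>a\<in>UNIV. f a) - (5 + 4 * sqrt 2) * (\<Sum>a\<in>UNIV. f a * Re (\<phi> a))"
    by (simp only: right_diff_distrib sum_subtractf mult.left_commute[of "f _"] mult.commute[of _ 3]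
      flip: sum_distrib_left)
  finally show ?thesis by simp
qed

section \<open>Spectral theory of real symmetric matrices\<close>

lemma symmetric_dot:
  fixes A :: "real^'n^'n"
  assumes "transpose A = A"
  shows "(A *v x) \<bullet> y = x \<bullet> (A *v y)"
  by (metis assms dot_lmul_matrix vector_transpose_matrix)

text \<open>A maximiser of the Rayleigh quotient on the unit sphere of \<open>S\<close> is an
  eigenvector. Working inside an invariant subspace allows eigenvectors to be split off one at a
  time.\<close>

lemma symmetric_eigenvector_in_subspace:
  fixes A :: "real^'n^'n"
  assumes sym: "transpose A = A" and S: "subspace S" and inv: "\<And>x. x \<in> S \<Longrightarrow> A *v x \<in> S"
    and "x0 \<in> S" "x0 \<noteq> 0"
  obtains u l where "u \<in> S" "norm u = 1" "A *v u = l *\<^sub>R u"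
proof -
  let ?K = "sphere 0 1 \<inter> S"
  have "compact ?K"
    by (intro compact_Int_closed closed_subspace S) auto
  moreover have "(1 / norm x0) *\<^sub>R x0 \<in> ?K"
    using assms by (simp add: subspace_scale)
  then have "?K \<noteq> {}" by blast
  moreover have "continuous_on ?K (\<lambda>x. x \<bullet> (A *v x))"
    by (intro continuous_intros matrix_vector_mult_linear_continuous_on)
  ultimately obtain u where u: "u \<in> ?K" and max: "\<And>y. y \<in> ?K \<Longrightarrow> y \<bullet> (A *v y) \<le> u \<bullet> (A *v u)"
    using continuous_attains_sup[of ?K "\<lambda>x. x \<bullet> (A *v x)"] by blast
  define l where "l = u \<bullet> (A *v u)"
  have rayleigh: "y \<bullet> (A *v y) \<le> l * (y \<bullet> y)" if "y \<in> S" for y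
  proof (cases "y = 0")
    case False
    have "(1 / norm y) *\<^sub>R y \<in> ?K"
      using that False S by (simp add: subspace_scale)
    from max[OF this] have "(y \<bullet> (A *v y)) / (norm y)\<^sup>2 \<le> l"
      by (simp add: l_def matrix_vector_mult_scaleR power2_eq_square)
    then show ?thesis
      using False by (simp add: field_simps power2_norm_eq_inner)
  qed simp
  \<comment> \<open>The residual of the eigenvector equation: it lies in \<open>S\<close> and is
    orthogonal to \<open>u\<close>, so the maximiser can be perturbed in its direction.\<close>
  define w where "w = l *\<^sub>R u - A *v u"
  have "w \<in> S"
    using u inv S by (simp add: w_def subspace_diff subspace_scale)
  have uu: "u \<bullet> u = 1"
    using u by (simp add: norm_eq_1)
  have uw: "u \<bullet> w = 0"
    by (simp add: w_def inner_diff_right uu l_def)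
  define q where "q = l * (w \<bullet> w) - w \<bullet> (A *v w)"
  have quad: "0 \<le> t\<^sup>2 * q + 2 * t * (w \<bullet> w)" for t
  proof -
    let ?y = "u + t *\<^sub>R w"
    have "?y \<in> S"
      using u \<open>w \<in> S\<close> S by (simp add: subspace_add subspace_scale)
    have "A *v u = l *\<^sub>R u - w"
      by (simp add: w_def)
    then have wAu: "w \<bullet> (A *v u) = - (w \<bullet> w)"
      using uw by (simp add: inner_diff_right inner_commute)
    then have uAw: "u \<bullet> (A *v w) = - (w \<bullet> w)"
      using symmetric_dot[OF sym, of u w] by (simp add: inner_commute)
    have "?y \<bullet> ?y = 1 + t\<^sup>2 * (w \<bullet> w)"
      using uu uw by (simp add: inner_add_left inner_add_right inner_commute[of w u] power2_eq_square)
    moreover have "?y \<bullet> (A *v ?y) = l - 2 * t * (w \<bullet> w) + t\<^sup>2 * (w \<bullet> (A *v w))"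
      using uAw wAu by (simp add: l_def matrix_vector_right_distrib matrix_vector_mult_scaleR
          inner_add_left inner_add_right power2_eq_square algebra_simps)
    ultimately have "l * (?y \<bullet> ?y) - ?y \<bullet> (A *v ?y) = t\<^sup>2 * q + 2 * t * (w \<bullet> w)"
      by (simp add: q_def algebra_simps)
    then show ?thesis
      using rayleigh[OF \<open>?y \<in> S\<close>] by simp
  qed
  \<comment> \<open>the linear term must vanish, as \<open>t\<close> may be small and negative\<close>
  have "w \<bullet> w = 0"
  proof (rule ccontr)
    assume "w \<bullet> w \<noteq> 0"
    then have pos: "w \<bullet> w > 0" by simp
    have "q \<ge> 0"
      using rayleigh[OF \<open>w \<in> S\<close>] by (simp add: q_def)
    \<comment> \<open>With this choice \<open>t * q + 2 * (w \<bullet> w)\<close> equals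
      \<open>w \<bullet> w - t\<close>, which is positive. The summand 1 keeps the denominator
      positive when \<open>q = 0\<close>.\<close>
    define t where "t = - (w \<bullet> w) / (q + 1)"
    have "t < 0"
      using pos \<open>q \<ge> 0\<close> by (simp add: t_def divide_less_0_iff)
    moreover have "0 \<le> t * (t * q + 2 * (w \<bullet> w))"
      using quad[of t] by (simp add: power2_eq_square algebra_simps)
    ultimately have "t * q + 2 * (w \<bullet> w) \<le> 0"
      by (simp add: zero_le_mult_iff)
    moreover have "t * q = - (w \<bullet> w) - t"
      using \<open>q \<ge> 0\<close> by (simp add: t_def field_simps)
    ultimately show False
      using pos \<open>t < 0\<close> by simp
  qed
  then have "A *v u = l *\<^sub>R u"
    by (simp add: w_def)
  then show thesis
    using u by (intro that[of u l]) simp_all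
qed

text \<open>By symmetry the orthogonal complement of a set of eigenvectors is invariant. It is
  nonzero while fewer than \<open>CARD('n)\<close> have been found, so it contains another.\<close>

lemma symmetric_orthonormal_eigenvectors:
  fixes A :: "real^'n^'n"
  assumes sym: "transpose A = A" and "k \<le> CARD('n)"
  shows "\<exists>B. finite B \<and> card B = k \<and> pairwise orthogonal B
    \<and> (\<forall>b\<in>B. norm b = 1 \<and> (\<exists>l. A *v b = l *\<^sub>R b))"
  using assms(2)
proof (induction k)
  case 0
  then show ?case by (intro exI[of _ "{}"]) auto
next
  case (Suc k)
  then obtain B where B: "finite B" "card B = k" "pairwise orthogonal B"
    and eig: "\<And>b. b \<in> B \<Longrightarrow> norm b = 1 \<and> (\<exists>l. A *v b = l *\<^sub>R b)"
    by auto
  define S where "S = {x. \<forall>b\<in>B. orthogonal x b}"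
  have "dim B \<le> k"
    using dim_le_card'[OF B(1)] B(2) by simp
  then have "dim B < DIM(real^'n)"
    using Suc.prems by simp
  then obtain x0 where "x0 \<noteq> 0" "\<And>y. y \<in> span B \<Longrightarrow> orthogonal x0 y"
    using orthogonal_to_subspace_exists by blast
  then have "x0 \<in> S"
    by (auto simp: S_def span_base)
  have "subspace S"
    by (auto simp: S_def subspace_def orthogonal_def inner_add_left)
  have "A *v x \<in> S" if "x \<in> S" for x
    unfolding S_def
  proof (intro CollectI ballI)
    fix b assume "b \<in> B"
    then obtain l where "A *v b = l *\<^sub>R b" using eig by blast
    then show "orthogonal (A *v x) b"
      using that \<open>b \<in> B\<close> by (simp add: S_def orthogonal_def symmetric_dot[OF sym])
  qed
  then obtain u l where u: "u \<in> S" "norm u = 1" "A *v u = l *\<^sub>R u"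
    using symmetric_eigenvector_in_subspace[OF sym \<open>subspace S\<close> _ \<open>x0 \<in> S\<close> \<open>x0 \<noteq> 0\<close>] by blast
  have "u \<notin> B"
    using u(1,2) by (auto simp: S_def orthogonal_self)
  then have "card (insert u B) = Suc k"
    using B by simp
  moreover have "pairwise orthogonal (insert u B)"
    using B(3) u(1) by (auto simp: pairwise_insert S_def orthogonal_commute)
  ultimately show ?case
    using B(1) eig u by (intro exI[of _ "insert u B"]) auto
qed

lemma symmetric_eigenbasis:
  fixes A :: "real^'n^'n"
  assumes "transpose A = A"
  obtains b :: "'n \<Rightarrow> real^'n" and l :: "'n \<Rightarrow> real"
  where "\<And>i j. b i \<bullet> b j = (if i = j then 1 else 0)" "\<And>i. A *v b i = l i *\<^sub>R b i"
proof -
  obtain B where B: "finite B" "card B = CARD('n)" "pairwise orthogonal B"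
    "\<forall>x\<in>B. norm x = 1 \<and> (\<exists>l. A *v x = l *\<^sub>R x)"
    using symmetric_orthonormal_eigenvectors[OF assms, of "CARD('n)"] by blast
  obtain b where b: "bij_betw b (UNIV :: 'n set) B"
    using finite_same_card_bij[OF finite_class.finite_UNIV B(1)] B(2) by auto
  have bB: "b i \<in> B" for i
    using b by (auto simp: bij_betw_def)
  have "b i \<bullet> b j = (if i = j then 1 else 0)" for i j
  proof (cases "i = j")
    case False
    then have "b i \<noteq> b j"
      using b by (auto simp: bij_betw_def inj_on_def)
    then show ?thesis
      using pairwiseD[OF B(3) bB bB] False by (simp add: orthogonal_def)
  next
    case True
    have "norm (b j) = 1" using B(4) bB by blast
    then show ?thesis using True by (simp add: norm_eq_1)
  qed
  moreover have "\<exists>c. A *v b i = c *\<^sub>R b i" for i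
    using B(4) bB by blast
  then obtain l where "\<And>i. A *v b i = l i *\<^sub>R b i"
    by metis
  ultimately show thesis by (rule that)
qed

section \<open>Characteristic polynomial and eigenvalue list from an eigenbasis\<close>

lemma map_matrix_const_poly_mult:
  fixes A B :: "real^'n^'n"
  shows "map_matrix (\<lambda>a. [:a:]) (A ** B) = map_matrix (\<lambda>a. [:a:]) A ** map_matrix (\<lambda>a. [:a:]) B"
proof -
  have "[:sum f UNIV:] = (\<Sum>k\<in>UNIV. [:f k:])" for f :: "'n \<Rightarrow> real"
    by (rule poly_eqI) (simp add: coeff_sum coeff_pCons split: nat.split)
  then show ?thesis
    by (simp add: vec_eq_iff matrix_matrix_mult_def mult.commute)
qed

text \<open>With the eigenvectors as columns of \<open>Q\<close>, the relation
  \<open>A ** Q = Q ** L\<close> lifts to polynomial matrices as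
  \<open>(x I - A) Q = Q (x I - L)\<close>. After taking determinants \<open>det Q\<close> cancels,
  being nonzero in an integral domain.\<close>

lemma char_polynomial_eigenbasis:
  fixes A :: "real^'n^'n" and b :: "'n \<Rightarrow> real^'n"
  assumes orth: "\<And>i j. b i \<bullet> b j = (if i = j then 1 else 0)"
    and eig: "\<And>i. A *v b i = l i *\<^sub>R b i"
  shows "char_polynomial A = (\<Prod>i\<in>UNIV. [:- l i, 1:])"
proof -
  let ?c = "map_matrix (\<lambda>a::real. [:a:])"
  let ?X = "mat [:0, 1:] :: real poly^'n^'n"
  define Q where "Q = (\<chi> i j. b j $ i)"
  define L where "L = diag_matrix l"
  have QQ: "transpose Q ** Q = mat 1"
    using orth by (simp add: vec_eq_iff Q_def matrix_matrix_mult_def transpose_def mat_def inner_vec_def)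
  have "A ** Q = Q ** L"
  proof -
    have "(A ** Q) $ i $ j = (Q ** L) $ i $ j" for i j
    proof -
      have "(A ** Q) $ i $ j = (A *v b j) $ i"
        by (simp add: matrix_matrix_mult_def matrix_vector_mult_def Q_def)
      also have "\<dots> = (Q ** L) $ i $ j"
        by (simp add: eig matrix_matrix_mult_def L_def diag_matrix_def Q_def if_distrib cong: if_cong)
      finally show ?thesis .
    qed
    then show ?thesis by (simp add: vec_eq_iff)
  qed
  then have AQ: "?c A ** ?c Q = ?c Q ** ?c L"
    by (metis map_matrix_const_poly_mult)
  have "?X ** ?c Q = ?c Q ** ?X"
    by (simp add: vec_eq_iff matrix_matrix_mult_def mat_def if_distrib if_distribR mult.commute cong: if_cong)
  with AQ have "(?X - ?c A) ** ?c Q = ?c Q ** (?X - ?c L)"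
    by (simp add: vec_eq_iff matrix_matrix_mult_def left_diff_distrib right_diff_distrib sum_subtractf
        del: mult_pCons_left mult_pCons_right)
  from arg_cong[OF this, of det] have "char_polynomial A * det (?c Q) = det (?c Q) * det (?X - ?c L)"
    by (simp add: det_mul char_polynomial_def)
  moreover have "det (?c Q) \<noteq> 0"
  proof
    assume "det (?c Q) = 0"
    then have "det (?c (transpose Q) ** ?c Q) = 0"
      by (simp add: det_mul)
    moreover have "?c (transpose Q) ** ?c Q = mat 1"
      unfolding map_matrix_const_poly_mult[symmetric] QQ by (simp add: vec_eq_iff mat_def)
    ultimately show False by simp
  qed
  ultimately have "char_polynomial A = det (?X - ?c L)"
    by simp
  also have "\<dots> = (\<Prod>i\<in>UNIV. (?X - ?c L) $ i $ i)"
    by (rule det_diagonal) (simp add: mat_def L_def diag_matrix_def)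
  finally show ?thesis
    by (simp add: mat_def L_def diag_matrix_def)
qed

lemma eigenvalue_list_eigenbasis:
  fixes A :: "real^'n^'n" and b :: "'n \<Rightarrow> real^'n"
  assumes "\<And>i j. b i \<bullet> b j = (if i = j then 1 else 0)"
    and "\<And>i. A *v b i = l i *\<^sub>R b i"
  shows "mset (eigenvalue_list A) = image_mset l (mset_set UNIV)"
proof -
  have "proots (char_polynomial A) = (\<Sum>i\<in>UNIV. {#l i#})"
    unfolding char_polynomial_eigenbasis[OF assms] by (subst proots_prod) auto
  also have "\<dots> = image_mset l (mset_set UNIV)"
    by (metis finite sum_unfold_sum_mset sum_mset_singleton_mset image_mset.compositionality)
  finally show ?thesis
    by (simp add: eigenvalue_list_def)
qed

text \<open>The two smallest list entries may coincide; attaching them to distinct members of an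
  orthonormal eigenbasis accounts for multiplicity.\<close>

lemma spectral_gap_eigenvectors:
  fixes A :: "real^'n^'n"
  assumes sym: "transpose A = A" and card: "CARD('n) \<ge> 2"
  obtains u w \<alpha> where "u \<noteq> 0" "w \<noteq> 0" "u \<bullet> w = 0" "A *v u = \<alpha> *\<^sub>R u"
    "A *v w = spectral_gap A *\<^sub>R w" "\<alpha> \<le> spectral_gap A"
proof -
  obtain b :: "'n \<Rightarrow> real^'n" and l where orth: "\<And>i j. b i \<bullet> b j = (if i = j then 1 else 0 :: real)"
    and eig: "\<And>i. A *v b i = l i *\<^sub>R b i"
    using symmetric_eigenbasis[OF sym] by blast
  have ms: "mset (eigenvalue_list A) = image_mset l (mset_set UNIV)"
    by (rule eigenvalue_list_eigenbasis[OF orth eig])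
  obtain ks where ks: "mset ks = mset_set (UNIV :: 'n set)"
    using ex_mset by blast
  \<comment> \<open>Sorting indices instead of eigenvalues records which eigenvector belongs to each
    position of the list.\<close>
  define js where "js = sort_key l ks"
  have "mset (map l js) = mset (eigenvalue_list A)"
    using ms ks by (simp add: js_def)
  then have list: "eigenvalue_list A = map l js"
    unfolding eigenvalue_list_def
    by (metis js_def mset_sorted_list_of_multiset sorted_list_of_multiset_mset sorted_sort_id sorted_sort_key)
  have "size (mset js) = CARD('n)"
    using ks by (simp add: js_def del: size_mset)
  then have len: "length js \<ge> 2"
    using card by simp
  have "mset js = mset_set (set js)"
    using ks by (metis js_def finite finite_set_mset_mset_set mset_sort set_mset_mset)
  then have "distinct js"
    by (metis distinct_count_atmost_1 count_mset_set' finite_set set_mset_mset)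
  then have ne: "js ! 0 \<noteq> js ! 1"
    using nth_eq_iff_index_eq[of js 0 1] len by linarith
  have gap: "spectral_gap A = l (js ! 1)"
    using len by (simp add: spectral_gap_def list)
  have "sorted (map l js)"
    by (simp add: js_def)
  then have "l (js ! 0) \<le> spectral_gap A"
    using len sorted_nth_mono[of "map l js" 0 1] nth_map[of 0 js l] nth_map[of 1 js l]
    unfolding gap by fastforce
  moreover have "b i \<noteq> 0" for i
    using orth[of i i] by auto
  ultimately show thesis
    using orth[of "js ! 0" "js ! 1"] ne eig[of "js ! 0"] eig[of "js ! 1"]
    by (intro that[of "b (js ! 0)" "b (js ! 1)" "l (js ! 0)"]) (simp_all add: gap)
qed

section \<open>Eigenvectors of convolution operators\<close>

text \<open>The sum of all group elements is invariant under translating every term by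
  \<open>g\<close>. Multiples of \<open>g\<close> are written \<open>\<Sum>i<j. g\<close>
  throughout.\<close>

lemma sum_const_card:
  fixes g :: "'a::{finite, ab_group_add}"
  shows "(\<Sum>i<CARD('a). g) = 0"
proof -
  have "(\<Sum>x\<in>UNIV. x + g) = (\<Sum>x\<in>UNIV. x)"
    by (rule sum_translate)
  then have "(\<Sum>x\<in>(UNIV :: 'a set). g) = 0"
    by (simp add: sum.distrib)
  moreover obtain h where "bij_betw h {..<CARD('a)} (UNIV :: 'a set)"
    using ex_bij_betw_nat_finite[of "UNIV :: 'a set"] by (auto simp: atLeast0LessThan)
  ultimately show ?thesis
    using sum.reindex_bij_betw[of h "{..<CARD('a)}" UNIV "\<lambda>_. g"] by simp
qed

text \<open>By De Moivre \<open>j\<close> and \<open>k\<close> exchange roles, which gives a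
  geometric sum whose ratio is an \<open>n\<close>-th root of unity other than 1.\<close>

lemma sum_root_unity_powers:
  fixes n j :: nat
  assumes "0 < j" "j < n"
  shows "(\<Sum>k<n. cis (2 * pi * k / n) ^ j) = 0"
proof -
  have "n > 0" using assms by simp
  define w where "w = cis (2 * pi * j / n)"
  have "w \<noteq> cis (2 * pi * (0::nat) / n)"
    using bij_betw_imp_inj_on[OF Complex.bij_betw_roots_unity[OF \<open>n > 0\<close>]] assms
    unfolding w_def inj_on_def by fastforce
  then have w1: "w \<noteq> 1" by simp
  have wn: "w ^ n = 1"
    using bij_betw_apply[OF Complex.bij_betw_roots_unity[OF \<open>n > 0\<close>], of j] assms by (simp add: w_def)
  have "(\<Sum>k<n. cis (2 * pi * k / n) ^ j) = (\<Sum>k<n. w ^ k)"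
    by (simp add: w_def Complex.DeMoivre mult_ac)
  also have "\<dots> = 0"
    using w1 wn by (simp add: sum_gp_strict)
  finally show ?thesis .
qed

section \<open>Translation-invariant spaces of functions and the characters they contain\<close>

definition translation_subspace :: "('a::{finite, ab_group_add} \<Rightarrow> complex) set \<Rightarrow> bool" where
  "translation_subspace W \<longleftrightarrow> (\<lambda>x. 0) \<in> W
    \<and> (\<forall>v\<in>W. \<forall>w\<in>W. (\<lambda>x. v x + w x) \<in> W)
    \<and> (\<forall>c. \<forall>v\<in>W. (\<lambda>x. c * v x) \<in> W)
    \<and> (\<forall>g. \<forall>v\<in>W. (\<lambda>x. v (x + g)) \<in> W)"

lemma translation_subspace_zero: "translation_subspace W \<Longrightarrow> (\<lambda>x. 0) \<in> W"
  by (simp add: translation_subspace_def)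

lemma translation_subspace_add:
  "translation_subspace W \<Longrightarrow> v \<in> W \<Longrightarrow> w \<in> W \<Longrightarrow> (\<lambda>x. v x + w x) \<in> W"
  by (simp add: translation_subspace_def)

lemma translation_subspace_scale:
  "translation_subspace W \<Longrightarrow> v \<in> W \<Longrightarrow> (\<lambda>x. c * v x) \<in> W"
  by (simp add: translation_subspace_def)

lemma translation_subspace_translate:
  "translation_subspace W \<Longrightarrow> v \<in> W \<Longrightarrow> (\<lambda>x. v (x + g)) \<in> W"
  by (simp add: translation_subspace_def)

lemma translation_subspace_sum:
  assumes "translation_subspace W" "\<And>i. i \<in> I \<Longrightarrow> v i \<in> W"
  shows "(\<lambda>x. \<Sum>i\<in>I. v i x) \<in> W"
  using assms(2)
proof (induction I rule: infinite_finite_induct)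
  case (insert i I)
  have "(\<lambda>x. v i x + (\<Sum>j\<in>I. v j x)) \<in> W"
    by (intro translation_subspace_add[OF assms(1)] insert.IH insert.prems) auto
  then show ?case
    using insert.hyps by simp
qed (simp_all add: translation_subspace_zero[OF assms(1)])

text \<open>Translation by \<open>g\<close> has order dividing \<open>CARD('a)\<close>, so
  \<open>v\<close> is a sum of eigenvectors for roots of unity, one of them nonzero. The
  coefficients \<open>e\<close> exhibit it as a combination of translates of \<open>v\<close>, so it
  stays in any translation-invariant subspace containing \<open>v\<close>.\<close>

lemma translation_eigenvector:
  fixes v :: "'a::{finite, ab_group_add} \<Rightarrow> complex"
  assumes "v x0 \<noteq> 0"
  shows "\<exists>e \<zeta>. (\<exists>x. (\<Sum>j<CARD('a). e j * v (x + (\<Sum>i<j. g))) \<noteq> 0)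
    \<and> (\<forall>x. (\<Sum>j<CARD('a). e j * v (x + g + (\<Sum>i<j. g)))
      = \<zeta> * (\<Sum>j<CARD('a). e j * v (x + (\<Sum>i<j. g))))"
proof -
  define n where "n = CARD('a)"
  have n: "n > 0" by (simp add: n_def)
  define \<zeta> where "\<zeta> = (\<lambda>k::nat. cis (2 * pi * k / n))"
  have \<zeta>n: "\<zeta> k ^ n = 1" if "k < n" for k
    using bij_betw_apply[OF Complex.bij_betw_roots_unity[OF n], of k] that by (simp add: \<zeta>_def)
  define u where "u = (\<lambda>(j::nat) x. v (x + (\<Sum>i<j. g)))"
  have un: "u n x = u 0 x" for x
    using sum_const_card[of g] by (simp add: u_def n_def)
  have ug: "u j (x + g) = u (Suc j) x" for j x
    by (simp add: u_def algebra_simps)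
  \<comment> \<open>up to a factor, \<open>w k\<close> is the projection of \<open>v\<close> to the \<open>\<zeta> k\<close>-eigenspace of translation by \<open>g\<close>\<close>
  define w where "w = (\<lambda>k x. \<Sum>j<n. \<zeta> k ^ (n - j) * u j x)"
  have shift: "w k (x + g) = \<zeta> k * w k x" if "k < n" for k x
  proof -
    \<comment> \<open>Adding the term \<open>j = n\<close> permits an index shift; the surplus terms
      \<open>\<zeta> k * u n x\<close> and \<open>\<zeta> k ^ Suc n * u 0 x\<close> agree.\<close>
    have "\<zeta> k * w k x = (\<Sum>j<n. \<zeta> k ^ Suc (n - j) * u j x)"
      by (simp add: w_def sum_distrib_left mult.assoc)
    also have "\<dots> + \<zeta> k * u n x = (\<Sum>j<Suc n. \<zeta> k ^ Suc (n - j) * u j x)"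
      by simp
    also have "\<dots> = \<zeta> k ^ Suc n * u 0 x + (\<Sum>j<n. \<zeta> k ^ Suc (n - Suc j) * u (Suc j) x)"
      by (subst sum.lessThan_Suc_shift) simp
    also have "(\<Sum>j<n. \<zeta> k ^ Suc (n - Suc j) * u (Suc j) x) = w k (x + g)"
      unfolding w_def ug by (intro sum.cong refl) (simp add: Suc_diff_Suc)
    finally show ?thesis
      using \<zeta>n[OF that] un by simp
  qed
  \<comment> \<open>Only \<open>j = 0\<close> survives the sum over \<open>k\<close>: there the
    exponent is \<open>n\<close> and every power is 1.\<close>
  have "(\<Sum>k<n. w k x0) = (\<Sum>j<n. (\<Sum>k<n. \<zeta> k ^ (n - j)) * u j x0)"
    unfolding w_def by (subst sum.swap) (simp add: sum_distrib_right)
  also have "\<dots> = (\<Sum>j\<in>{0}. (\<Sum>k<n. \<zeta> k ^ (n - j)) * u j x0)"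
  proof (rule sum.mono_neutral_right)
    show "\<forall>j\<in>{..<n} - {0}. (\<Sum>k<n. \<zeta> k ^ (n - j)) * u j x0 = 0"
    proof
      fix j assume "j \<in> {..<n} - {0}"
      then have "0 < n - j" "n - j < n" by auto
      then show "(\<Sum>k<n. \<zeta> k ^ (n - j)) * u j x0 = 0"
        unfolding \<zeta>_def by (simp only: sum_root_unity_powers mult_zero_left)
    qed
  qed (use n in auto)
  also have "\<dots> = of_nat n * v x0"
    using \<zeta>n by (simp add: u_def)
  finally have "(\<Sum>k<n. w k x0) \<noteq> 0"
    using assms n by simp
  then obtain k where k: "k < n" "w k x0 \<noteq> 0"
    using sum.not_neutral_contains_not_neutral by blast
  have w_eq: "w k x = (\<Sum>j<CARD('a). \<zeta> k ^ (n - j) * v (x + (\<Sum>i<j. g)))" for x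
    by (simp only: w_def u_def n_def)
  show ?thesis
    by (rule exI[of _ "\<lambda>j. \<zeta> k ^ (n - j)"], rule exI[of _ "\<zeta> k"], unfold w_eq[symmetric])
      (use k(2) shift[OF k(1)] in blast)
qed

text \<open>Projecting to an eigenspace of translation by a new \<open>g\<close> stays in
  \<open>W\<close> and, since translations commute, preserves the eigenvector relations already
  obtained.\<close>

lemma common_translation_eigenvector:
  fixes W :: "('a::{finite, ab_group_add} \<Rightarrow> complex) set"
  assumes W: "translation_subspace W" and "v \<in> W" "v \<noteq> (\<lambda>x. 0)"
  shows "\<exists>w\<in>W. w \<noteq> (\<lambda>x. 0) \<and> (\<forall>g\<in>G. \<exists>c. \<forall>x. w (x + g) = c * w x)"
proof -
  have "finite G" by simp
  then show ?thesis
  proof (induction G rule: finite_induct)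
    case empty
    then show ?case using assms by blast
  next
    case (insert g G)
    then obtain w where w: "w \<in> W" "w \<noteq> (\<lambda>x. 0)" "\<forall>h\<in>G. \<exists>c. \<forall>x. w (x + h) = c * w x"
      by blast
    then obtain x0 where "w x0 \<noteq> 0" by blast
    from translation_eigenvector[of w x0 g, OF this]
    obtain e \<zeta> where e: "\<exists>x. (\<Sum>j<CARD('a). e j * w (x + (\<Sum>i<j. g))) \<noteq> 0"
      and shift: "\<forall>x. (\<Sum>j<CARD('a). e j * w (x + g + (\<Sum>i<j. g)))
        = \<zeta> * (\<Sum>j<CARD('a). e j * w (x + (\<Sum>i<j. g)))"
      by - (erule exE, erule exE, erule conjE, rule that)
    define u where "u = (\<lambda>x. \<Sum>j<CARD('a). e j * w (x + (\<Sum>i<j. g)))"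
    have "(\<lambda>x. e j * w (x + (\<Sum>i<j. g))) \<in> W" for j
      by (intro translation_subspace_scale[OF W, where v = "\<lambda>x. w (x + _)"]
        translation_subspace_translate[OF W] w(1))
    then have "u \<in> W"
      unfolding u_def by (intro translation_subspace_sum[OF W])
    moreover have "u \<noteq> (\<lambda>x. 0)"
      using e unfolding u_def fun_eq_iff by simp
    moreover have "\<exists>c. \<forall>x. u (x + h) = c * u x" if "h \<in> insert g G" for h
    proof (cases "h = g")
      case True
      then show ?thesis using shift unfolding u_def by blast
    next
      case False
      then obtain c where c: "\<And>x. w (x + h) = c * w x"
        using \<open>h \<in> insert g G\<close> w(3) by blast
      have "w (x + h + y) = c * w (x + y)" for x y
        using c[of "x + y"] by (simp add: add_ac)
      then have "u (x + h) = c * u x" for x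
        by (simp add: u_def sum_distrib_left mult_ac)
      then show ?thesis by blast
    qed
    ultimately show ?case by blast
  qed
qed

text \<open>A common eigenvector \<open>w\<close> of all translations is \<open>w 0\<close> times
  its eigenvalue function \<open>\<phi>\<close>, and composing translations makes
  \<open>\<phi>\<close> multiplicative.\<close>

lemma translation_subspace_character:
  fixes W :: "('a::{finite, ab_group_add} \<Rightarrow> complex) set"
  assumes W: "translation_subspace W" and "v \<in> W" "v \<noteq> (\<lambda>x. 0)"
  obtains \<phi> where "character \<phi>" "\<phi> \<in> W"
proof -
  obtain w where w: "w \<in> W" "w \<noteq> (\<lambda>x. 0)" and eig: "\<forall>g\<in>UNIV. \<exists>c. \<forall>x. w (x + g) = c * w x"
    using common_translation_eigenvector[OF assms, of UNIV] by blast
  from eig have "\<exists>c. \<forall>x. w (x + g) = c * w x" for g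
    by simp
  then obtain \<phi> where \<phi>: "\<And>g x. w (x + g) = \<phi> g * w x"
    by metis
  have w_eq: "w g = \<phi> g * w 0" for g
    using \<phi>[of 0 g] by simp
  have w0: "w 0 \<noteq> 0"
    using w(2) w_eq by (metis mult_zero_right ext)
  have "character \<phi>"
    unfolding character_def
  proof (intro conjI allI)
    show "\<phi> 0 = 1" using w_eq[of 0] w0 by simp
    fix a b
    show "\<phi> (a + b) = \<phi> a * \<phi> b"
      using \<phi>[of b a] w_eq[of "b + a"] w_eq[of b] w0 by (simp add: add.commute)
  qed
  moreover have "(\<lambda>x. inverse (w 0) * w x) \<in> W"
    by (rule translation_subspace_scale[OF W w(1)])
  moreover have "(\<lambda>x. inverse (w 0) * w x) = \<phi>"
  proof
    show "inverse (w 0) * w x = \<phi> x" for x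
      using w0 by (subst w_eq[of x]) simp
  qed
  ultimately show thesis using that by simp
qed

text \<open>The mean-zero complex eigenfunctions for \<open>l\<close> form a translation-invariant
  space, so a character is among them; mean zero excludes the trivial one.\<close>

lemma convolution_eigenvalue_character:
  fixes f v :: "'a::{finite, ab_group_add} \<Rightarrow> real"
  assumes eig: "\<And>x. (\<Sum>y\<in>UNIV. f (x - y) * v y) = l * v x"
    and mean0: "(\<Sum>x\<in>UNIV. v x) = 0" and "v x0 \<noteq> 0"
  obtains \<phi> g where "character \<phi>" "\<phi> g \<noteq> 1" "l = (\<Sum>a\<in>UNIV. f a * Re (\<phi> a))"
proof -
  define W where "W = {w :: 'a \<Rightarrow> complex. (\<Sum>x\<in>UNIV. w x) = 0
    \<and> (\<forall>x. (\<Sum>y\<in>UNIV. of_real (f y) * w (x - y)) = of_real l * w x)}"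
  have W: "translation_subspace W"
    unfolding translation_subspace_def
  proof (intro conjI ballI allI)
    fix u w c g assume uw: "u \<in> W" "w \<in> W"
    show "(\<lambda>x. u x + w x) \<in> W"
      using uw by (auto simp: W_def sum.distrib distrib_left)
    show "(\<lambda>x. c * u x) \<in> W"
      using uw by (auto simp: W_def mult.left_commute simp flip: sum_distrib_left)
    show "(\<lambda>x. u (x + g)) \<in> W"
    proof -
      have "(\<Sum>y\<in>UNIV. of_real (f y) * u (x - y + g)) = of_real l * u (x + g)" for x
        using uw unfolding W_def by (simp add: diff_add_eq)
      then show ?thesis
        using uw by (simp add: W_def sum_translate)
    qed
  qed (simp add: W_def)
  have "(\<lambda>x. of_real (v x)) \<in> W"
  proof -
    have "(\<Sum>y\<in>UNIV. f y * v (x - y)) = l * v x" for x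
      using eig[of x] sum_reflect[of "\<lambda>y. f y * v (x - y)" x] by simp
    then show ?thesis
      unfolding W_def using mean0
      by (simp flip: of_real_sum of_real_mult)
  qed
  moreover have "(\<lambda>x. complex_of_real (v x)) \<noteq> (\<lambda>x. 0)"
    using \<open>v x0 \<noteq> 0\<close> by (auto simp: fun_eq_iff)
  ultimately obtain \<phi> where \<phi>: "character \<phi>" "\<phi> \<in> W"
    using translation_subspace_character[OF W] by blast
  have "\<exists>g. \<phi> g \<noteq> 1"
  proof (rule ccontr)
    assume "\<not> ?thesis"
    then have "(\<Sum>x\<in>UNIV. \<phi> x) = of_nat CARD('a)" by simp
    then show False using \<phi>(2) by (simp add: W_def)
  qed
  moreover have "l = (\<Sum>a\<in>UNIV. f a * Re (\<phi> a))"
  proof -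
    \<comment> \<open>Evaluation at 0 isolates the eigenvalue; taking real parts then removes the
      conjugation in \<open>\<phi> (- y)\<close>.\<close>
    have "(\<Sum>y\<in>UNIV. of_real (f y) * \<phi> (0 - y)) = of_real l * \<phi> 0"
      using \<phi>(2) unfolding W_def by blast
    then have "(\<Sum>y\<in>UNIV. of_real (f y) * cnj (\<phi> y)) = of_real l"
      using \<phi>(1) by (simp add: character_minus character_def)
    from arg_cong[OF this, of Re] show ?thesis by simp
  qed
  ultimately show thesis using that \<phi>(1) by blast
qed

section \<open>The normalized distance Laplacian\<close>

text \<open>An eigenvector not orthogonal to the null vector \<open>e\<close> has eigenvalue 0. If
  this happens for the gap, then 0 is a double eigenvalue, against the positivity in
  \<open>pos\<close>. The predicate \<open>P\<close> serves both bounds at once.\<close>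

lemma spectral_gap_ge:
  fixes A :: "real^'n^'n"
  assumes sym: "transpose A = A" and card: "CARD('n) \<ge> 2" and null: "A *v e = 0"
    and pos: "\<And>v \<mu>. v \<noteq> 0 \<Longrightarrow> e \<bullet> v = 0 \<Longrightarrow> A *v v = \<mu> *\<^sub>R v \<Longrightarrow> 0 < \<mu> \<and> P \<mu>"
  shows "P (spectral_gap A)"
proof -
  obtain u w \<alpha> where u: "u \<noteq> 0" "A *v u = \<alpha> *\<^sub>R u" and w: "w \<noteq> 0" "A *v w = spectral_gap A *\<^sub>R w"
    and uw: "u \<bullet> w = 0" and le: "\<alpha> \<le> spectral_gap A"
    by (rule spectral_gap_eigenvectors[OF sym card])
  have orth: "\<mu> = 0 \<or> e \<bullet> v = 0" if "A *v v = \<mu> *\<^sub>R v" for v \<mu>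
    using symmetric_dot[OF sym, of e v] that null by simp
  show ?thesis
  proof (cases "e \<bullet> w = 0")
    case True
    then show ?thesis using pos w by blast
  next
    case False
    then have gap0: "spectral_gap A = 0" using orth w(2) by blast
    have "\<alpha> = 0"
    proof (rule ccontr)
      assume "\<alpha> \<noteq> 0"
      then have "0 < \<alpha>" using orth[OF u(2)] pos[OF u(1) _ u(2)] by blast
      then show False using le gap0 by simp
    qed
    \<comment> \<open>a two-dimensional kernel meets the orthogonal complement of \<open>e\<close>\<close>
    define v where "v = (e \<bullet> w) *\<^sub>R u - (e \<bullet> u) *\<^sub>R w"
    have "A *v v = 0 *\<^sub>R v"
      using u(2) w(2) \<open>\<alpha> = 0\<close> gap0
      by (simp add: v_def matrix_vector_mult_diff_distrib matrix_vector_mult_scaleR)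
    moreover have "e \<bullet> v = 0"
      by (simp add: v_def inner_diff_right)
    moreover have "v \<noteq> 0"
    proof
      assume "v = 0"
      moreover have "u \<bullet> v = (e \<bullet> w) * (u \<bullet> u)"
        using uw by (simp add: v_def inner_diff_right)
      ultimately show False using False u(1) by simp
    qed
    ultimately show ?thesis using pos by blast
  qed
qed

lemma diag_matrix_mult_nth:
  fixes M :: "real^'m::finite^'n::finite"
  shows "(diag_matrix f ** M ** diag_matrix g) $ u $ v = f u * M $ u $ v * g v"
proof -
  have left: "(diag_matrix f ** M) $ u $ v = f u * M $ u $ v" for u v
    by (simp add: matrix_matrix_mult_def diag_matrix_def mult_delta_left)
  have "(N ** diag_matrix g) $ u $ v = N $ u $ v * g v" for N :: "real^'m^'n" and u v
    by (simp add: matrix_matrix_mult_def diag_matrix_def mult_delta_right)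
  then show ?thesis
    by (simp add: left)
qed

lemma normalized_distance_laplacian_const_transmission:
  assumes "\<And>u. transmission d u = t" "t > 0"
  shows "normalized_distance_laplacian d = mat 1 - (1 / t) *\<^sub>R distance_matrix d"
proof -
  define r where "r = t powr (- 1 / 2)"
  have "r * r = 1 / t"
    using assms(2) unfolding r_def by (simp add: powr_minus_divide flip: powr_add)
  then have rr: "r * x * r = x / t" for x
    by (metis mult.commute mult.left_commute mult.right_neutral times_divide_eq_right)
  have "normalized_distance_laplacian d $ u $ v
      = (transmission_matrix d $ u $ v - d u v) / t" for u v
    unfolding normalized_distance_laplacian_def transmission_matrix_inv_sqrt_def assms(1)
      diag_matrix_mult_nth r_def[symmetric] rr
    by (simp add: distance_matrix_def)
  then show ?thesis
    using assms by (simp add: vec_eq_iff transmission_matrix_def diag_matrix_def distance_matrix_def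
        mat_def diff_divide_distrib)
qed

theorem theorem5p2:
  fixes d :: "'a::{finite, ab_group_add} \<Rightarrow> 'a \<Rightarrow> real"
  assumes "CARD('a) \<ge> 2"
    and "Metric_space UNIV d"
    and "\<And>u v w. d u v = d (u + w) (v + w)"
  shows "spectral_gap (normalized_distance_laplacian d) \<ge> 2 / 3
    \<and> (odd CARD('a) \<longrightarrow> spectral_gap (normalized_distance_laplacian d) > 0.718)"
proof -
  interpret Metric_space UNIV d by (rule assms(2))
  define f where "f = (\<lambda>g. d g 0)"
  have d_eq: "d u v = f (u - v)" for u v
    using assms(3)[of u v "- v"] by (simp add: f_def)
  have f_nonneg: "0 \<le> f a" for a
    by (simp add: f_def)
  \<comment> \<open>The triangle inequality along \<open>a + b\<close>, \<open>b\<close>, 0, whose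
    first leg has length \<open>f a\<close>.\<close>
  have f_sub: "f (a + b) \<le> f a + f b" for a b
    using triangle[of "a + b" b 0] by (simp add: d_eq)
  define t where "t = (\<Sum>a\<in>UNIV. f a)"
  have trans: "transmission d u = t" for u
    by (simp add: transmission_def d_eq t_def sum_reflect)
  have "(UNIV :: 'a set) \<noteq> {0}"
  proof
    assume "(UNIV :: 'a set) = {0}"
    then have "CARD('a) = card {0 :: 'a}" by (rule arg_cong)
    then show False using assms(1) by simp
  qed
  then obtain a :: 'a where "a \<noteq> 0"
    by blast
  then have "f a > 0"
    using f_nonneg[of a] zero[of a 0] by (simp add: f_def less_le)
  then have t: "t > 0"
    unfolding t_def using f_nonneg by (intro sum_pos2[of _ a]) auto
  define A where "A = normalized_distance_laplacian d"
  have A_eq: "A = mat 1 - (1 / t) *\<^sub>R distance_matrix d"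
    unfolding A_def by (rule normalized_distance_laplacian_const_transmission[OF trans t])
  have A_mult: "(A *v x) $ u = x $ u - (\<Sum>v\<in>UNIV. f (u - v) * x $ v) / t" for x u
  proof -
    have "A *v x = x - (1 / t) *\<^sub>R (distance_matrix d *v x)"
      unfolding A_eq matrix_vector_mult_diff_rdistrib by (simp add: scaleR_matrix_vector_assoc)
    then show ?thesis
      by (simp add: matrix_vector_mult_def distance_matrix_def d_eq)
  qed
  have sym: "transpose A = A"
    by (auto simp: A_eq vec_eq_iff transpose_def mat_def distance_matrix_def commute)
  have null: "A *v 1 = 0"
    using t by (simp add: vec_eq_iff A_mult sum_reflect flip: t_def)
  have pos: "0 < \<mu> \<and> 2 / 3 \<le> \<mu> \<and> (odd CARD('a) \<longrightarrow> 0.718 < \<mu>)"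
    if v: "v \<noteq> 0" "1 \<bullet> v = 0" "A *v v = \<mu> *\<^sub>R v" for v \<mu>
  proof -
    obtain x0 where "v $ x0 \<noteq> 0"
      using v(1) by (auto simp: vec_eq_iff)
    \<comment> \<open>An eigenvalue \<open>\<mu>\<close> of the Laplacian corresponds to
      \<open>t * (1 - \<mu>)\<close> for convolution with \<open>f\<close>.\<close>
    moreover have "(\<Sum>y\<in>UNIV. f (x - y) * v $ y) = (t * (1 - \<mu>)) * v $ x" for x
    proof -
      have "v $ x - (\<Sum>y\<in>UNIV. f (x - y) * v $ y) / t = \<mu> * v $ x"
        using A_mult[of v x] v(3) by simp
      then show ?thesis
        using t by (simp add: field_simps)
    qed
    moreover have "(\<Sum>x\<in>UNIV. v $ x) = 0"
      using v(2) by (simp add: inner_vec_def)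
    ultimately obtain \<phi> g where \<phi>: "character \<phi>" "\<phi> g \<noteq> 1"
      and ev: "t * (1 - \<mu>) = (\<Sum>a\<in>UNIV. f a * Re (\<phi> a))"
      using convolution_eigenvalue_character[of f "($) v" "t * (1 - \<mu>)" x0] by blast
    have "3 * (t * (1 - \<mu>)) \<le> t"
      unfolding ev unfolding t_def by (rule subadditive_character_le[OF f_sub f_nonneg \<phi>])
    then have "t * (3 * (1 - \<mu>)) \<le> t * 1"
      by (simp add: algebra_simps)
    then have ge: "2 / 3 \<le> \<mu>"
      using t by simp
    have "0.718 < \<mu>" if "odd CARD('a)"
    proof -
      have "(5 + 4 * sqrt 2) * (t * (1 - \<mu>)) \<le> 3 * t"
        unfolding ev unfolding t_def by (rule subadditive_character_le_odd[OF f_sub \<phi> that])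
      then have "t * ((5 + 4 * sqrt 2) * (1 - \<mu>)) \<le> t * 3"
        by (simp add: algebra_simps)
      then have *: "(5 + 4 * sqrt 2) * (1 - \<mu>) \<le> 3"
        using t by simp
      \<comment> \<open>This precision suffices: \<open>5 + 4 * 1.41 = 10.64\<close>, and
        \<open>10.64 * 0.282 = 3.00048\<close> just exceeds 3, where
        \<open>0.282 = 1 - 0.718\<close>.\<close>
      have "1.41 < sqrt 2"
        by (rule real_less_rsqrt) (simp add: power2_eq_square)
      show ?thesis
      proof (rule ccontr)
        assume "\<not> ?thesis"
        then have "10.64 * 0.282 \<le> (5 + 4 * sqrt 2) * (1 - \<mu>)"
          using \<open>1.41 < sqrt 2\<close> by (intro mult_mono) auto
        with * show False by simp
      qed
    qed
    with ge show ?thesis by simp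
  qed
  have "2 / 3 \<le> spectral_gap A \<and> (odd CARD('a) \<longrightarrow> 0.718 < spectral_gap A)"
    by (rule spectral_gap_ge[OF sym assms(1) null]) (use pos in blast)
  then show ?thesis by (simp add: A_def)
qed

end
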